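(* Let $(\mathcal{X},\mathcal{A})$ be a $t$-$(v,k,\lambda)$ design with $b$ blocks, no block being repeated, and let $K_1,K_2$ be positive integers with $K_1K_2=v$ and $K_2\le t$. For each $s\in[t-1]$ let $a_s\in\{0,1,\ldots,\lambda_s^t\}$ be an integer, chosen so that $\sum_{s=1}^{t-1}a_s\binom{t}{s}>\lambda_1$. Then there exists a $(K_1,K_2,K';F,F';Z_1,Z_2,Z';\mathcal{S},\mathcal{S}_1,\ldots,\mathcal{S}_{K_1})$ hierarchical hotplug placement delivery array (HHPDA) $(\mathbf{Q},\mathbf{B})$ with $$K'=t,\qquad F=b,\qquad F'=\sum_{s=1}^{t-1}a_s\binom{t}{s},$$ $$Z_1=\lambda_{K_2},\qquad Z_2=\lambda_1-\lambda_{K_2},\qquad Z'=\sum_{s=1}^{t-1}a_s\binom{t-1}{s-1},$$ $$|\mathcal{S}|=\sum_{s=1}^{t-1}a_s\binom{t}{s+1},\qquad |\mathcal{S}_{k_1}|=\lambda_{K_2}K_2\ \text{ for all } k_1\in[K_1].$$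
   Context: Notation: $[n]=\{1,\ldots,n\}$. **Designs.** For positive integers $v>k\ge t$ and $\lambda$, a $t$-$(v,k,\lambda)$ design is a pair $(\mathcal{X},\mathcal{A})$ where $\mathcal{X}$ is a set of $v$ points and $\mathcal{A}$ is a collection (multiset) of $k$-element subsets of $\mathcal{X}$, called blocks, such that every set of $t$ distinct points is contained in exactly $\lambda$ blocks. For $0\le s\le t$, $\lambda_s=\lambda\binom{v-s}{t-s}/\binom{k-s}{t-s}$ is the number of blocks containing any given $s$ points; $b=\lambda_0$. For $1\le s\le t-1$, $\lambda_s^t=\lambda\binom{v-t}{k-s}/\binom{v-t}{k-t}$ is the number of blocks $A$ with $A\cap T=Y$, for any given set $T$ of $t$ points and any $Y\subseteq T$ with $|Y|=s$. **PDA.** A $(K,F,Z,S)$ placement delivery array is an $F\times K$ array $(p_{j,k})$ whose entries are the symbol $\star$ or one of $S$ integers (which may be taken from any fixed set of $S$ integers) such that: (C1) $\star$ appears exactly $Z$ times in each column; (C2) each of the $S$ integers occurs at least once; (C3) if two distinct entries $p_{j_1,k_1}=p_{j_2,k_2}$ are the same integer, then $j_1\ne j_2$, $k_1\neq k_2$ and $p_{j_1,k_2}=p_{j_2,k_1}=\star$. **HHPDA.** Let $K_1,K_2,K',F,F',Z_1,Z_2,Z'$ be positive integers with $Z_1+Z_2<F'\le F$ and $K'\le K_1K_2$, and let $\mathcal{S},\mathcal{S}_1,\ldots,\mathcal{S}_{K_1}$ be integer sets with $\mathcal{S}\cap\mathcal{S}_{k_1}=\emptyset$ for all $k_1\in[K_1]$.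 A $(K_1,K_2,K';F,F';Z_1,Z_2,Z';\mathcal{S},\mathcal{S}_1,\ldots,\mathcal{S}_{K_1})$ HHPDA is a pair $(\mathbf{Q},\mathbf{B})$ as follows. (i) $\mathbf{Q}=(\mathbf{Q}^{(0)},\mathbf{Q}^{(1)},\ldots,\mathbf{Q}^{(K_1)})$ is an $F\times(K_1+K_1K_2)$ array, where $\mathbf{Q}^{(0)}=(q^{(0)}_{f,k_1})_{f\in[F],k_1\in[K_1]}$ has entries in $\{\star,\text{null}\}$ and, for $k_1\in[K_1]$, $\mathbf{Q}^{(k_1)}=(q^{(k_1)}_{f,k_2})_{f\in[F],k_2\in[K_2]}$ has entries in $\{\star\}\cup\{\text{null}\}\cup\mathcal{S}_{k_1}$, such that: - (A1) each column of $\mathbf{Q}^{(0)}$ has $Z_1$ stars; - (A2) each column of each $\mathbf{Q}^{(k_1)}$, $k_1\in[K_1]$, has $Z_2$ stars; - (A3) each integer $s\in\mathcal{S}_{k_1}$ occurs in exactly the subarray $\mathbf{Q}^{(k_1)}$ (and in no other); and if $q^{(0)}_{f,k_1}=\star$ then $q^{(k_1)}_{f,k_2}\in\{\star\}\cup\mathcal{S}_{k_1}$, for all $f\in[F]$, $k_1\in[K_1]$, $k_2\in[K_2]$; - (A4) for two distinct entries of the same $\mathbf{Q}^{(k_1)}$, $q^{(k_1)}_{f,k_i}=q^{(k_1)}_{f',k_j}=s\in\mathcal{S}_{k_1}$ only if $f\ne f'$, $k_i\ne k_j$ and $q^{(k_1)}_{f,k_j}=q^{(k_1)}_{f',k_i}=\star$.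 (ii) $\mathbf{B}=(b_{f',k})_{f'\in[F'],k\in[K']}$ is a $(K',F',Z',|\mathcal{S}|)$ PDA whose integers are the elements of $\mathcal{S}$. (iii) For each $\tau\subseteq[K_1]\times[K_2]$ with $|\tau|=K'$ there is a subset $\zeta\subseteq[F]$ with $|\zeta|=F'$, its elements listed in some order (not necessarily increasing), such that $\mathbf{Q}'_{\zeta,\tau}\stackrel{\star}{=}\mathbf{B}$. Here $\mathbf{Q}'_{\zeta,\tau}$ is the $F'\times K'$ array with rows indexed by $\zeta$ (in the given order) and columns by $\tau$ (in lexicographic order), whose entry at $(f',(k_1,k_2))$ is $\star$ if $q^{(0)}_{f',k_1}=\star$ or $q^{(k_1)}_{f',k_2}=\star$, and null otherwise; and $\stackrel{\star}{=}$ means that the stars are in the same positions in both arrays.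
   Formalization: For K_2=1 the stated Z_2=λ_1-λ_{K_2} equals 0, contradicting the requirement that Z_2 be positive; in that case the array is shown to satisfy all HHPDA conditions except positivity of Z_2, while for K_2≥2 the full claim is proved. *)

theory Defs
  imports Complex_Main "HOL-Library.Multiset" "HOL-Library.Product_Lexorder"
begin

section \<open>Designs\<close>

definition design :: "nat \<Rightarrow> nat \<Rightarrow> nat \<Rightarrow> nat \<Rightarrow> 'a set \<Rightarrow> 'a set multiset \<Rightarrow> bool" where
  "design t v k l X \<A> \<longleftrightarrow>
     0 < t \<and> t \<le> k \<and> k < v \<and> 0 < l \<and>
     finite X \<and> card X = v \<and>
     (\<forall>A \<in># \<A>. A \<subseteq> X \<and> card A = k) \<and>
     (\<forall>T. T \<subseteq> X \<and> card T = t \<longrightarrow> size {#A \<in># \<A>. T \<subseteq> A#} = l)"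

text \<open>
  The two quotients below are integers whenever a design with these parameters exists. They are
  kept rational so that this is not built into a truncating division. Only arguments
  \<open>s \<le> t \<le> k < v\<close> are relevant.
\<close>

definition lambda_in :: "nat \<Rightarrow> nat \<Rightarrow> nat \<Rightarrow> nat \<Rightarrow> nat \<Rightarrow> rat" where
  "lambda_in t v k l s =
     of_nat l * of_nat ((v - s) choose (t - s)) / of_nat ((k - s) choose (t - s))"

definition lambda_trace :: "nat \<Rightarrow> nat \<Rightarrow> nat \<Rightarrow> nat \<Rightarrow> nat \<Rightarrow> rat" where
  "lambda_trace t v k l s =
     of_nat l * of_nat ((v - t) choose (k - s)) / of_nat ((v - t) choose (k - t))"

section \<open>Placement delivery arrays\<close>

datatype entry = Star | Null | Num int

text \<open>Arrays are functions of a row and a column index, both counted from 1; values outside the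
  index ranges are irrelevant.\<close>

type_synonym array = "nat \<Rightarrow> nat \<Rightarrow> entry"

definition col_stars :: "nat \<Rightarrow> array \<Rightarrow> nat \<Rightarrow> nat" where
  "col_stars F P k = card {j \<in> {1..F}. P j k = Star}"

text \<open>Used both for PDAs and for the subarrays of an HHPDA; \<open>S\<close> is the set of integers
  to which the condition applies.\<close>

definition delivery_cond :: "nat \<Rightarrow> nat \<Rightarrow> int set \<Rightarrow> array \<Rightarrow> bool" where
  "delivery_cond K F S P \<longleftrightarrow>
     (\<forall>s \<in> S. \<forall>j1 \<in> {1..F}. \<forall>j2 \<in> {1..F}. \<forall>k1 \<in> {1..K}. \<forall>k2 \<in> {1..K}.
        (j1, k1) \<noteq> (j2, k2) \<and> P j1 k1 = Num s \<and> P j2 k2 = Num s \<longrightarrow>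
        j1 \<noteq> j2 \<and> k1 \<noteq> k2 \<and> P j1 k2 = Star \<and> P j2 k1 = Star)"

definition PDA :: "nat \<Rightarrow> nat \<Rightarrow> nat \<Rightarrow> nat \<Rightarrow> int set \<Rightarrow> array \<Rightarrow> bool" where
  "PDA K F Z n S P \<longleftrightarrow>
     finite S \<and> card S = n \<and>
     (\<forall>j \<in> {1..F}. \<forall>k \<in> {1..K}. P j k \<in> {Star} \<union> Num ` S) \<and>
     (\<forall>k \<in> {1..K}. col_stars F P k = Z) \<and>
     (\<forall>s \<in> S. \<exists>j \<in> {1..F}. \<exists>k \<in> {1..K}. P j k = Num s) \<and>
     delivery_cond K F S P"

section \<open>Hierarchical hotplug placement delivery arrays\<close>

text \<open>
  \<open>Q k1\<close> is the subarray \<open>Q\<^sup>(\<^sup>k\<^sup>1\<^sup>)\<close> for \<open>0 \<le> k1 \<le> K1\<close>; \<open>Q 0\<close> has \<open>K1\<close> columns and the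
  others have \<open>K2\<close> columns.
\<close>

definition hotplug_entry :: "(nat \<Rightarrow> array) \<Rightarrow> nat \<Rightarrow> nat \<times> nat \<Rightarrow> entry" where
  "hotplug_entry Q f c =
     (if Q 0 f (fst c) = Star \<or> Q (fst c) f (snd c) = Star then Star else Null)"

text \<open>The subarray with rows \<open>r 1, r 2, \<dots>\<close> and columns \<open>\<tau>\<close>; the order on pairs is the
  lexicographic one.\<close>

definition hotplug_sub :: "(nat \<Rightarrow> array) \<Rightarrow> (nat \<Rightarrow> nat) \<Rightarrow> (nat \<times> nat) set \<Rightarrow> array" where
  "hotplug_sub Q r \<tau> i j = hotplug_entry Q (r i) (sorted_list_of_set \<tau> ! (j - 1))"

definition star_equal :: "nat \<Rightarrow> nat \<Rightarrow> array \<Rightarrow> array \<Rightarrow> bool" where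
  "star_equal F K P R \<longleftrightarrow>
     (\<forall>i \<in> {1..F}. \<forall>j \<in> {1..K}. P i j = Star \<longleftrightarrow> R i j = Star)"

text \<open>
  All conditions on an HHPDA except positivity of \<open>Z2\<close>. In the construction from designs
  \<open>Z2 = \<lambda>\<^sub>1 - \<lambda>\<^bsub>K2\<^esub>\<close>, which is \<open>0\<close> exactly if \<open>K2 = 1\<close>.
\<close>

definition HHPDA_relaxed ::
  "nat \<Rightarrow> nat \<Rightarrow> nat \<Rightarrow> nat \<Rightarrow> nat \<Rightarrow> nat \<Rightarrow> nat \<Rightarrow> nat \<Rightarrow> int set \<Rightarrow> (nat \<Rightarrow> int set) \<Rightarrow>
   (nat \<Rightarrow> array) \<Rightarrow> array \<Rightarrow> bool" where
  "HHPDA_relaxed K1 K2 K' F F' Z1 Z2 Z' S SS Q B \<longleftrightarrow>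
     0 < K1 \<and> 0 < K2 \<and> 0 < K' \<and> 0 < F \<and> 0 < F' \<and> 0 < Z1 \<and> 0 < Z' \<and>
     Z1 + Z2 < F' \<and> F' \<le> F \<and> K' \<le> K1 * K2 \<and>
     (\<forall>k1 \<in> {1..K1}. S \<inter> SS k1 = {}) \<and>
     (\<forall>f \<in> {1..F}. \<forall>k1 \<in> {1..K1}. Q 0 f k1 \<in> {Star, Null}) \<and>
     (\<forall>k1 \<in> {1..K1}. \<forall>f \<in> {1..F}. \<forall>k2 \<in> {1..K2}.
        Q k1 f k2 \<in> {Star, Null} \<union> Num ` SS k1) \<and>
     (\<forall>k1 \<in> {1..K1}. col_stars F (Q 0) k1 = Z1) \<and>
     (\<forall>k1 \<in> {1..K1}. \<forall>k2 \<in> {1..K2}. col_stars F (Q k1) k2 = Z2) \<and>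
     (\<forall>k1 \<in> {1..K1}. \<forall>s \<in> SS k1.
        (\<exists>f \<in> {1..F}. \<exists>k2 \<in> {1..K2}. Q k1 f k2 = Num s) \<and>
        (\<forall>f \<in> {1..F}. \<forall>k \<in> {1..K1}. Q 0 f k \<noteq> Num s) \<and>
        (\<forall>k1' \<in> {1..K1} - {k1}. \<forall>f \<in> {1..F}. \<forall>k2 \<in> {1..K2}. Q k1' f k2 \<noteq> Num s)) \<and>
     (\<forall>f \<in> {1..F}. \<forall>k1 \<in> {1..K1}. \<forall>k2 \<in> {1..K2}.
        Q 0 f k1 = Star \<longrightarrow> Q k1 f k2 \<in> {Star} \<union> Num ` SS k1) \<and>
     (\<forall>k1 \<in> {1..K1}. delivery_cond K2 F (SS k1) (Q k1)) \<and>
     PDA K' F' Z' (card S) S B \<and>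
     (\<forall>\<tau>. \<tau> \<subseteq> {1..K1} \<times> {1..K2} \<and> card \<tau> = K' \<longrightarrow>
        (\<exists>\<zeta> r. \<zeta> \<subseteq> {1..F} \<and> card \<zeta> = F' \<and> bij_betw r {1..F'} \<zeta> \<and>
               star_equal F' K' (hotplug_sub Q r \<tau>) B))"

definition HHPDA ::
  "nat \<Rightarrow> nat \<Rightarrow> nat \<Rightarrow> nat \<Rightarrow> nat \<Rightarrow> nat \<Rightarrow> nat \<Rightarrow> nat \<Rightarrow> int set \<Rightarrow> (nat \<Rightarrow> int set) \<Rightarrow>
   (nat \<Rightarrow> array) \<Rightarrow> array \<Rightarrow> bool" where
  "HHPDA K1 K2 K' F F' Z1 Z2 Z' S SS Q B \<longleftrightarrow>
     0 < Z2 \<and> HHPDA_relaxed K1 K2 K' F F' Z1 Z2 Z' S SS Q B"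

end

theory Submission
  imports Defs "HOL-Library.Nat_Bijection"
begin

text \<open>
  Identify the points with the users \<open>(k1, k2)\<close>, and let \<open>G k1\<close> be the points with first
  coordinate \<open>k1\<close>. In the row of a block \<open>A\<close> the stars of \<open>Q\<close> are placed so that user \<open>x\<close> sees
  one iff \<open>x \<in> A\<close>: the star sits in \<open>Q 0\<close> if \<open>G k1 \<subseteq> A\<close>, where \<open>Q k1\<close> is then filled with
  integers occurring only once, and in \<open>Q k1\<close> otherwise. The rows of \<open>B\<close> are \<open>a s\<close> copies of every
  \<open>s\<close>-subset \<open>Y\<close> of the \<open>t\<close> columns, with stars at \<open>Y\<close>. For a set \<open>T\<close> of \<open>t\<close> active users, each
  \<open>Y \<subseteq> T\<close> is the trace \<open>A \<inter> T\<close> of at least \<open>a s\<close> blocks, so the rows of \<open>B\<close> embed into \<open>Q\<close>.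
\<close>

section \<open>Counting subsets\<close>

text \<open>Deleting \<open>I\<close> is a bijection onto the subsets of \<open>D - I\<close> of
  size \<open>n - card I\<close>, with adding \<open>I\<close> as its inverse.\<close>

lemma card_subsets_between:
  assumes "finite D" "I \<subseteq> D" "card I \<le> n"
  shows "card {T. I \<subseteq> T \<and> T \<subseteq> D \<and> card T = n} = (card D - card I) choose (n - card I)"
proof -
  have finI: "finite I" using assms finite_subset by blast
  have "bij_betw (\<lambda>T. T - I) {T. I \<subseteq> T \<and> T \<subseteq> D \<and> card T = n}
          {U. U \<subseteq> D - I \<and> card U = n - card I}"
  proof (rule bij_betw_byWitness[where f' = "\<lambda>U. U \<union> I"])
    show "(\<lambda>T. T - I) ` {T. I \<subseteq> T \<and> T \<subseteq> D \<and> card T = n}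
            \<subseteq> {U. U \<subseteq> D - I \<and> card U = n - card I}"
      using finI by (auto simp: card_Diff_subset)
    have "card (U \<union> I) = n" if "U \<subseteq> D - I" "card U = n - card I" for U
    proof -
      have "finite U" "U \<inter> I = {}" using that assms(1) finite_subset by blast+
      then show ?thesis using that assms(3) finI by (simp add: card_Un_disjoint)
    qed
    then show "(\<lambda>U. U \<union> I) ` {U. U \<subseteq> D - I \<and> card U = n - card I}
                 \<subseteq> {T. I \<subseteq> T \<and> T \<subseteq> D \<and> card T = n}"
      using assms(2) by blast
  qed auto
  then have "card {T. I \<subseteq> T \<and> T \<subseteq> D \<and> card T = n} = card {U. U \<subseteq> D - I \<and> card U = n - card I}"
    by (rule bij_betw_same_card)
  also have "\<dots> = card (D - I) choose (n - card I)"
    using assms(1) by (intro n_subsets) auto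
  finally show ?thesis
    using assms finI by (simp add: card_Diff_subset)
qed

text \<open>Subsets are grouped by size. With \<open>I = {}\<close> this counts rows and symbols of
  the array \<open>B\<close>, with \<open>I = {c}\<close> the stars of column
  \<open>c\<close>.\<close>

lemma sum_over_subsets_by_card:
  fixes g :: "nat \<Rightarrow> nat"
  assumes "finite D" "I \<subseteq> D" "finite N" "\<And>n. n \<in> N \<Longrightarrow> card I \<le> n"
  shows "(\<Sum>Y | I \<subseteq> Y \<and> Y \<subseteq> D \<and> card Y \<in> N. g (card Y)) =
         (\<Sum>n\<in>N. g n * ((card D - card I) choose (n - card I)))"
proof -
  let ?P = "{Y. I \<subseteq> Y \<and> Y \<subseteq> D \<and> card Y \<in> N}"
  have "finite ?P" by (rule finite_subset[of _ "Pow D"]) (use assms(1) in auto)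
  then have "(\<Sum>Y\<in>?P. g (card Y)) = (\<Sum>n\<in>N. \<Sum>Y | Y \<in> ?P \<and> card Y = n. g (card Y))"
    using assms(3) by (intro sum.group[symmetric]) auto
  also have "\<dots> = (\<Sum>n\<in>N. g n * ((card D - card I) choose (n - card I)))"
  proof (rule sum.cong)
    fix n assume n: "n \<in> N"
    have "(\<Sum>Y | Y \<in> ?P \<and> card Y = n. g (card Y)) =
          (\<Sum>Y | I \<subseteq> Y \<and> Y \<subseteq> D \<and> card Y = n. g n)"
      using n by (intro sum.cong) auto
    also have "\<dots> = g n * ((card D - card I) choose (n - card I))"
      using card_subsets_between[OF assms(1,2) assms(4)[OF n]] by simp
    finally show "(\<Sum>Y | Y \<in> ?P \<and> card Y = n. g (card Y)) =
                  g n * ((card D - card I) choose (n - card I))" .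
  qed simp
  finally show ?thesis .
qed

section \<open>Designs as indexed families of blocks\<close>

text \<open>An index set replaces the multiset of blocks: counts of blocks become cardinalities of
  sets of indices, which later are the row numbers of \<open>Q\<close>.\<close>

locale indexed_design =
  fixes t v k l :: nat and X :: "'a set" and J :: "'i set" and blk :: "'i \<Rightarrow> 'a set"
  assumes t_pos: "0 < t" and t_le_k: "t \<le> k" and k_less_v: "k < v" and l_pos: "0 < l"
    and finite_X: "finite X" and card_X: "card X = v" and finite_J: "finite J"
    and blk_subset: "f \<in> J \<Longrightarrow> blk f \<subseteq> X"
    and card_blk: "f \<in> J \<Longrightarrow> card (blk f) = k"
    and balance: "T \<subseteq> X \<Longrightarrow> card T = t \<Longrightarrow> card {f \<in> J. T \<subseteq> blk f} = l"
begin

lemma finite_blk: "f \<in> J \<Longrightarrow> finite (blk f)"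
  using blk_subset finite_X finite_subset by blast

text \<open>Double counting of the pairs \<open>(T, f)\<close> with \<open>I \<subseteq> T \<subseteq> blk f\<close> and \<open>card T = t\<close>.\<close>

lemma card_containing_mult:
  assumes "I \<subseteq> X" "card I \<le> t"
  shows "card {f \<in> J. I \<subseteq> blk f} * ((k - card I) choose (t - card I)) =
         l * ((v - card I) choose (t - card I))"
proof -
  let ?TT = "{T. I \<subseteq> T \<and> T \<subseteq> X \<and> card T = t}"
  have finTT: "finite ?TT" by (rule finite_subset[of _ "Pow X"]) (use finite_X in auto)
  have "l * ((v - card I) choose (t - card I)) = (\<Sum>T\<in>?TT. card {f \<in> J. T \<subseteq> blk f})"
    using card_subsets_between[OF finite_X assms] by (simp add: balance card_X)
  also have "\<dots> = (\<Sum>T\<in>?TT. \<Sum>f\<in>J. if T \<subseteq> blk f then 1 else 0)"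
    using finite_J by (simp add: sum.If_cases Int_def)
  also have "\<dots> = (\<Sum>f\<in>J. \<Sum>T\<in>?TT. if T \<subseteq> blk f then 1 else 0)"
    by (rule sum.swap)
  also have "\<dots> = (\<Sum>f\<in>J. card {T \<in> ?TT. T \<subseteq> blk f})"
    using finTT by (simp add: sum.If_cases Int_def)
  also have "\<dots> = (\<Sum>f\<in>J. if I \<subseteq> blk f then (k - card I) choose (t - card I) else 0)"
  proof (rule sum.cong)
    fix f assume f: "f \<in> J"
    show "card {T \<in> ?TT. T \<subseteq> blk f} =
          (if I \<subseteq> blk f then (k - card I) choose (t - card I) else 0)"
    proof (cases "I \<subseteq> blk f")
      case True
      have "{T \<in> ?TT. T \<subseteq> blk f} = {T. I \<subseteq> T \<and> T \<subseteq> blk f \<and> card T = t}"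
        using blk_subset[OF f] by auto
      then show ?thesis
        using True card_subsets_between[OF finite_blk[OF f] True assms(2)] card_blk[OF f] by simp
    next
      case False
      then have "{T \<in> ?TT. T \<subseteq> blk f} = {}" by blast
      then show ?thesis using False by (simp only: card.empty if_False)
    qed
  qed simp
  also have "\<dots> = card {f \<in> J. I \<subseteq> blk f} * ((k - card I) choose (t - card I))"
    using finite_J by (simp add: sum.If_cases Int_def)
  finally show ?thesis by simp
qed

lemma card_containing:
  assumes "I \<subseteq> X" "card I \<le> t"
  shows "of_nat (card {f \<in> J. I \<subseteq> blk f}) = lambda_in t v k l (card I)"
proof -
  have "(k - card I) choose (t - card I) > 0" using assms(2) t_le_k by simp
  moreover have "of_nat (card {f \<in> J. I \<subseteq> blk f}) * of_nat ((k - card I) choose (t - card I)) =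
        (of_nat l * of_nat ((v - card I) choose (t - card I)) :: rat)"
    using card_containing_mult[OF assms] by (metis of_nat_mult)
  ultimately show ?thesis
    unfolding lambda_in_def by (simp add: field_simps)
qed

text \<open>Induction on \<open>H\<close>: to avoid a further point \<open>x\<close>, subtract the
  blocks that contain \<open>insert x I\<close> and avoid \<open>H\<close>; Pascal's rule performs
  the same subtraction on the binomials. The factor \<open>(v - t) choose (k - t)\<close> avoids
  division.\<close>

lemma card_containing_avoiding:
  assumes "finite H" "I \<subseteq> X" "H \<subseteq> X" "I \<inter> H = {}" "card I + card H \<le> t"
  shows "card {f \<in> J. I \<subseteq> blk f \<and> blk f \<inter> H = {}} * ((v - t) choose (k - t)) =
         l * ((v - card I - card H) choose (k - card I))"
  using assms
proof (induction H arbitrary: I rule: finite_induct)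
  case empty
  let ?i = "card I"
  have i: "?i \<le> t" using empty by simp
  \<comment> \<open>Trinomial revision turns the count of \<open>card_containing_mult\<close> into
    the required one, up to the positive factor \<open>(k - ?i) choose (t - ?i)\<close>, which
    cancels.\<close>
  have "((v - ?i) choose (k - ?i)) * ((k - ?i) choose (t - ?i)) =
        ((v - ?i) choose (t - ?i)) * ((v - t) choose (k - t))"
    using choose_mult[of "t - ?i" "k - ?i" "v - ?i"] i t_le_k k_less_v
    by simp
  moreover have "card {f \<in> J. I \<subseteq> blk f} * ((k - ?i) choose (t - ?i)) =
                 l * ((v - ?i) choose (t - ?i))"
    using card_containing_mult empty(1) i by blast
  ultimately have "((k - ?i) choose (t - ?i)) * (card {f \<in> J. I \<subseteq> blk f} * ((v - t) choose (k - t)))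
                 = ((k - ?i) choose (t - ?i)) * (l * ((v - ?i) choose (k - ?i)))"
    by algebra
  moreover have "(k - ?i) choose (t - ?i) > 0" using i t_le_k by simp
  ultimately show ?case by simp
next
  case (insert x H)
  let ?i = "card I" and ?h = "card H" and ?c = "(v - t) choose (k - t)"
  let ?N = "\<lambda>I. {f \<in> J. I \<subseteq> blk f \<and> blk f \<inter> H = {}}"
  have finI: "finite I" using insert.prems finite_X finite_subset by blast
  have "x \<notin> I" using insert.prems by auto
  then have cI: "card (Set.insert x I) = Suc ?i" using finI by simp
  have le: "Suc (?i + ?h) \<le> t" using insert by simp
  have 1: "card (?N I) * ?c = l * ((v - ?i - ?h) choose (k - ?i))"
    using insert.prems le by (intro insert.IH) auto
  have 2: "card (?N (Set.insert x I)) * ?c = l * ((v - Suc ?i - ?h) choose (k - Suc ?i))"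
    using insert.IH[of "Set.insert x I"] insert.prems insert.hyps le cI by auto
  have "?N I = {f \<in> J. I \<subseteq> blk f \<and> blk f \<inter> Set.insert x H = {}} \<union> ?N (Set.insert x I)"
    by auto
  moreover have "{f \<in> J. I \<subseteq> blk f \<and> blk f \<inter> Set.insert x H = {}} \<inter> ?N (Set.insert x I) = {}"
    by auto
  ultimately have 3: "card (?N I) = card {f \<in> J. I \<subseteq> blk f \<and> blk f \<inter> Set.insert x H = {}}
                              + card (?N (Set.insert x I))"
    using finite_J by (simp add: card_Un_disjoint)
  \<comment> \<open>\<open>?i + ?h < t\<close> makes both truncated differences genuine successors,
    so that Pascal's rule applies.\<close>
  have e: "v - ?i - ?h = Suc (v - Suc ?i - ?h)" "k - ?i = Suc (k - Suc ?i)"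
    using le t_le_k k_less_v by auto
  have "(v - ?i - ?h) choose (k - ?i) =
        ((v - Suc ?i - ?h) choose (k - Suc ?i)) + ((v - Suc ?i - ?h) choose (k - ?i))"
    by (metis e binomial_Suc_Suc)
  with 1 2 3 have "card {f \<in> J. I \<subseteq> blk f \<and> blk f \<inter> Set.insert x H = {}} * ?c =
      l * ((v - Suc ?i - ?h) choose (k - ?i))"
    by (simp add: algebra_simps)
  then show ?case using insert.hyps by simp
qed

text \<open>A block has trace \<open>Y\<close> on \<open>T\<close> iff it contains \<open>Y\<close>
  and avoids \<open>T - Y\<close>. The two sets have \<open>t\<close> points together, so
  \<open>card_containing_avoiding\<close> applies.\<close>

lemma card_trace:
  assumes "T \<subseteq> X" "card T = t" "Y \<subseteq> T"
  shows "of_nat (card {f \<in> J. blk f \<inter> T = Y}) = lambda_trace t v k l (card Y)"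
proof -
  have finT: "finite T" using assms finite_X finite_subset by blast
  then have cY: "card Y \<le> t" "card (T - Y) = t - card Y"
    using assms card_mono card_Diff_subset finite_subset by metis+
  have "{f \<in> J. blk f \<inter> T = Y} = {f \<in> J. Y \<subseteq> blk f \<and> blk f \<inter> (T - Y) = {}}"
    using assms(3) by blast
  then have "card {f \<in> J. blk f \<inter> T = Y} * ((v - t) choose (k - t)) =
        l * ((v - card Y - card (T - Y)) choose (k - card Y))"
    using card_containing_avoiding[of "T - Y" Y] assms finT cY
    by (metis (no_types, lifting) Diff_disjoint Diff_subset finite_Diff le_add_diff_inverse
        order.refl subset_trans)
  moreover have "v - card Y - card (T - Y) = v - t" using cY by simp
  ultimately have "of_nat (card {f \<in> J. blk f \<inter> T = Y}) * of_nat ((v - t) choose (k - t)) =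
        (of_nat l * of_nat ((v - t) choose (k - card Y)) :: rat)"
    by (metis of_nat_mult)
  moreover have "(v - t) choose (k - t) > 0" using k_less_v by simp
  ultimately show ?thesis unfolding lambda_trace_def by (simp add: field_simps)
qed

end

section \<open>Positivity and strict decrease of the replication numbers\<close>

lemma lambda_in_pos:
  assumes "0 < l" "s \<le> t" "t \<le> k" "k < v"
  shows "0 < lambda_in t v k l s"
  unfolding lambda_in_def using assms by simp

text \<open>By the absorption identity the quotient of the values at \<open>s\<close> and
  \<open>Suc s\<close> is (v - s) / (k - s), which exceeds 1 because \<open>k < v\<close>.\<close>

lemma lambda_in_Suc_less:
  assumes "0 < l" "s < t" "t \<le> k" "k < v"
  shows "lambda_in t v k l (Suc s) < lambda_in t v k l s"
proof -
  have e: "Suc (t - Suc s) = t - s" "Suc (v - Suc s) = v - s" "Suc (k - Suc s) = k - s"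
    using assms by auto
  let ?V = "(v - Suc s) choose (t - Suc s)" and ?K = "(k - Suc s) choose (t - Suc s)"
  let ?V' = "(v - s) choose (t - s)" and ?K' = "(k - s) choose (t - s)"
  have "(t - s) * ?V' = (v - s) * ?V" "(t - s) * ?K' = (k - s) * ?K"
    using Suc_times_binomial[of "t - Suc s" "v - Suc s"]
      Suc_times_binomial[of "t - Suc s" "k - Suc s"] unfolding e by simp_all
  then have "(t - s) * (?V * ?K') = (k - s) * (?V * ?K)" "(t - s) * (?V' * ?K) = (v - s) * (?V * ?K)"
    by (metis mult.assoc mult.left_commute)+
  moreover have "(k - s) * (?V * ?K) < (v - s) * (?V * ?K)"
    using assms by (intro mult_strict_right_mono) auto
  ultimately have "(t - s) * (?V * ?K') < (t - s) * (?V' * ?K)" by (simp only:)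
  then have "?V * ?K' < ?V' * ?K" by (simp only: mult_less_cancel1)
  then have "l * ?V * ?K' < l * ?V' * ?K" using assms(1) by (simp only: mult.assoc mult_less_cancel1)
  then have "(of_nat l * of_nat ?V * of_nat ?K' :: rat) < of_nat l * of_nat ?V' * of_nat ?K"
    by (metis of_nat_mult of_nat_less_iff)
  moreover have "?K > 0" "?K' > 0" using assms by auto
  ultimately show ?thesis
    unfolding lambda_in_def by (simp add: divide_simps)
qed

lemma lambda_in_less:
  assumes "0 < l" "s < s'" "s' \<le> t" "t \<le> k" "k < v"
  shows "lambda_in t v k l s' < lambda_in t v k l s"
  using assms(2,3)
proof (induction s')
  case (Suc s')
  have "lambda_in t v k l (Suc s') < lambda_in t v k l s'"
    using lambda_in_Suc_less assms Suc by simp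
  then show ?case using Suc by (cases "s = s'") auto
qed simp

section \<open>The placement delivery array of subsets\<close>

text \<open>The second component numbers the copies of a star pattern. As \<open>Y\<close> is
  neither empty nor full, each row has both a star and an integer.\<close>

definition subset_rows :: "nat \<Rightarrow> (nat \<Rightarrow> nat) \<Rightarrow> (nat set \<times> nat) set" where
  "subset_rows t a = (SIGMA Y:{Y. Y \<subseteq> {1..t} \<and> card Y \<in> {1..t - 1}}. {..<a (card Y)})"

text \<open>The sets \<open>W\<close> arise from a row set by adding one column, hence the shifted
  size range and the copy bound \<open>a (card W - 1)\<close>.\<close>

definition subset_symbols :: "nat \<Rightarrow> (nat \<Rightarrow> nat) \<Rightarrow> (nat set \<times> nat) set" where
  "subset_symbols t a = (SIGMA W:{W. W \<subseteq> {1..t} \<and> card W \<in> {2..t}}. {..<a (card W - 1)})"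

lemma finite_subsets_card: "finite {Y. Y \<subseteq> {1..t::nat} \<and> card Y \<in> N}"
  by (rule finite_subset[of _ "Pow {1..t}"]) auto

lemma finite_subset_rows: "finite (subset_rows t a)"
  unfolding subset_rows_def using finite_subsets_card by (intro finite_SigmaI) auto

lemma finite_subset_symbols: "finite (subset_symbols t a)"
  unfolding subset_symbols_def using finite_subsets_card by (intro finite_SigmaI) auto

lemma card_subset_rows: "card (subset_rows t a) = (\<Sum>s = 1..t - 1. a s * (t choose s))"
  using sum_over_subsets_by_card[of "{1..t}" "{}" "{1..t - 1}" a] finite_subsets_card
  unfolding subset_rows_def by (subst card_SigmaI) auto

lemma card_subset_symbols:
  "card (subset_symbols t a) = (\<Sum>s = 1..t - 1. a s * (t choose (s + 1)))"
proof -
  have "card (subset_symbols t a) = (\<Sum>s = 2..t. a (s - 1) * (t choose s))"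
    using sum_over_subsets_by_card[of "{1..t}" "{}" "{2..t}" "\<lambda>s. a (s - 1)"] finite_subsets_card
    unfolding subset_symbols_def by (subst card_SigmaI) auto
  also have "\<dots> = (\<Sum>s = 1..t - 1. a s * (t choose (s + 1)))"
    by (rule sum.reindex_bij_witness[of _ Suc "\<lambda>s. s - 1"]) auto
  finally show ?thesis .
qed

lemma card_subset_rows_containing:
  assumes "c \<in> {1..t}"
  shows "card {p \<in> subset_rows t a. c \<in> fst p} =
         (\<Sum>s = 1..t - 1. a s * ((t - 1) choose (s - 1)))"
proof -
  have "{p \<in> subset_rows t a. c \<in> fst p} =
        (SIGMA Y:{Y. {c} \<subseteq> Y \<and> Y \<subseteq> {1..t} \<and> card Y \<in> {1..t - 1}}. {..<a (card Y)})"
    unfolding subset_rows_def by auto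
  also have "card \<dots> = (\<Sum>s = 1..t - 1. a s * ((t - 1) choose (s - 1)))"
  proof (subst card_SigmaI)
    show "finite {Y. {c} \<subseteq> Y \<and> Y \<subseteq> {1..t} \<and> card Y \<in> {1..t - 1}}"
      by (rule finite_subset[of _ "Pow {1..t}"]) auto
    show "(\<Sum>Y | {c} \<subseteq> Y \<and> Y \<subseteq> {1..t} \<and> card Y \<in> {1..t - 1}. card {..<a (card Y)}) =
          (\<Sum>s = 1..t - 1. a s * ((t - 1) choose (s - 1)))"
      using sum_over_subsets_by_card[of "{1..t}" "{c}" "{1..t - 1}" a] assms by simp
  qed simp
  finally show ?thesis .
qed

lemma insert_row_in_symbols:
  assumes "p \<in> subset_rows t a" "c \<in> {1..t}" "c \<notin> fst p"
  shows "(insert c (fst p), snd p) \<in> subset_symbols t a"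
proof -
  have "finite (fst p)" using assms(1) unfolding subset_rows_def by (auto dest: finite_subset[OF _ finite_atLeastAtMost])
  then show ?thesis
    using assms unfolding subset_rows_def subset_symbols_def by auto
qed

text \<open>Deleting any column \<open>c\<close> from \<open>W\<close> gives a row where the symbol
  is placed; \<open>2 \<le> card W\<close> keeps that row set nonempty. This makes every integer of
  the PDA occur.\<close>

lemma symbol_from_row:
  assumes "w \<in> subset_symbols t a"
  obtains p c where "p \<in> subset_rows t a" "c \<in> {1..t}" "c \<notin> fst p"
    "w = (insert c (fst p), snd p)"
proof -
  obtain W i where w: "w = (W, i)" and W: "W \<subseteq> {1..t}" "2 \<le> card W" "card W \<le> t"
    and i: "i < a (card W - 1)"
    using assms unfolding subset_symbols_def by auto
  have "W \<noteq> {}" using W by auto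
  then obtain c where c: "c \<in> W" by auto
  have "finite W" using W(1) finite_subset by blast
  then have "card (W - {c}) = card W - 1" using c by simp
  then have "(W - {c}, i) \<in> subset_rows t a"
    unfolding subset_rows_def using W i by auto
  then show thesis using that[of "(W - {c}, i)" c] c W w by (auto simp: insert_absorb)
qed

text \<open>An integer names a pair \<open>(W, i)\<close>; it is placed in column \<open>c\<close> of the row \<open>(W - {c}, i)\<close>
  for every \<open>c \<in> W\<close>.\<close>

lemma ex_subset_PDA:
  assumes rho: "bij_betw \<rho> {1..F} (subset_rows t a)"
  obtains S B where
    "PDA t F (\<Sum>s = 1..t - 1. a s * ((t - 1) choose (s - 1))) (card S) S B"
    "card S = (\<Sum>s = 1..t - 1. a s * (t choose (s + 1)))"
    "S \<subseteq> {..<0}"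
    "\<And>i c. B i c = Star \<longleftrightarrow> c \<in> fst (\<rho> i)"
proof -
  obtain h :: "nat set \<times> nat \<Rightarrow> nat" where h: "inj_on h (subset_symbols t a)"
    using finite_imp_inj_to_nat_seg[OF finite_subset_symbols] by blast
  \<comment> \<open>All these integers are negative, even for \<open>h w = 0\<close>; the
    nonnegative ones are reserved for the subarrays of \<open>Q\<close>.\<close>
  define num where "num w = - int (h w) - 1" for w
  have num_inj: "inj_on num (subset_symbols t a)"
    using h unfolding num_def inj_on_def by auto
  define S where "S = num ` subset_symbols t a"
  define B where "B i c = (if c \<in> fst (\<rho> i) then Star
                           else Num (num (insert c (fst (\<rho> i)), snd (\<rho> i))))" for i c
  have rho_in: "\<rho> i \<in> subset_rows t a" if "i \<in> {1..F}" for i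
    using rho that by (rule bij_betw_apply)
  have sym_in: "(insert c (fst (\<rho> i)), snd (\<rho> i)) \<in> subset_symbols t a"
    if "i \<in> {1..F}" "c \<in> {1..t}" "c \<notin> fst (\<rho> i)" for i c
    using that by (intro insert_row_in_symbols rho_in)
  have stars: "col_stars F B c = (\<Sum>s = 1..t - 1. a s * ((t - 1) choose (s - 1)))"
    if "c \<in> {1..t}" for c
  proof -
    have "bij_betw \<rho> {i \<in> {1..F}. B i c = Star} {p \<in> subset_rows t a. c \<in> fst p}"
      using rho by (rule bij_betw_Collect) (simp add: B_def)
    then have "card {i \<in> {1..F}. B i c = Star} = card {p \<in> subset_rows t a. c \<in> fst p}"
      by (rule bij_betw_same_card)
    then show ?thesis
      using card_subset_rows_containing[OF that] unfolding col_stars_def by simp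
  qed
  have occurs: "\<exists>i\<in>{1..F}. \<exists>c\<in>{1..t}. B i c = Num x" if x: "x \<in> S" for x
  proof -
    obtain w where w: "w \<in> subset_symbols t a" "x = num w" using x unfolding S_def by auto
    obtain p c where p: "p \<in> subset_rows t a" "c \<in> {1..t}" "c \<notin> fst p"
      "w = (insert c (fst p), snd p)"
      using symbol_from_row[OF w(1)] .
    obtain i where "i \<in> {1..F}" "\<rho> i = p"
      using rho p(1) by (metis bij_betw_imp_surj_on imageE)
    moreover from this have "B i c = Num x" using p w unfolding B_def by simp
    ultimately show ?thesis using p(2) by blast
  qed
  have deliver: "delivery_cond t F S B"
    unfolding delivery_cond_def
  proof (intro ballI impI)
    fix x i1 i2 c1 c2
    assume i: "i1 \<in> {1..F}" "i2 \<in> {1..F}" and c: "c1 \<in> {1..t}" "c2 \<in> {1..t}"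
      and eq: "(i1, c1) \<noteq> (i2, c2) \<and> B i1 c1 = Num x \<and> B i2 c2 = Num x"
    have n: "c1 \<notin> fst (\<rho> i1)" "c2 \<notin> fst (\<rho> i2)"
      using eq unfolding B_def by (auto split: if_splits)
    then have "num (insert c1 (fst (\<rho> i1)), snd (\<rho> i1)) = num (insert c2 (fst (\<rho> i2)), snd (\<rho> i2))"
      using eq unfolding B_def by auto
    then have sets: "insert c1 (fst (\<rho> i1)) = insert c2 (fst (\<rho> i2))" "snd (\<rho> i1) = snd (\<rho> i2)"
      using inj_onD[OF num_inj] sym_in i c n by blast+
    \<comment> \<open>Removing a common column from the common set \<open>W\<close> would give the
      same set and copy number, hence the same row.\<close>
    have ne: "c1 \<noteq> c2"
    proof
      assume e: "c1 = c2"
      then have "fst (\<rho> i1) = fst (\<rho> i2)" using sets n by (metis insert_ident)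
      then have "\<rho> i1 = \<rho> i2" using sets by (simp add: prod_eq_iff)
      then have "i1 = i2" using rho i unfolding bij_betw_def inj_on_def by blast
      then show False using e eq by simp
    qed
    \<comment> \<open>Each of the two columns lies in \<open>W\<close> and differs from the column
      deleted in the other row, so that row has a star there. This also separates the rows.\<close>
    then have "c2 \<in> fst (\<rho> i1)" "c1 \<in> fst (\<rho> i2)" using sets(1) by (metis insertE insertI1)+
    then show "i1 \<noteq> i2 \<and> c1 \<noteq> c2 \<and> B i1 c2 = Star \<and> B i2 c1 = Star"
      using n ne unfolding B_def by auto
  qed
  have "PDA t F (\<Sum>s = 1..t - 1. a s * ((t - 1) choose (s - 1))) (card S) S B"
    unfolding PDA_def
  proof (intro conjI ballI)
    show "finite S" unfolding S_def using finite_subset_symbols by simp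
    show "B i c \<in> {Star} \<union> Num ` S" if "i \<in> {1..F}" "c \<in> {1..t}" for i c
      using sym_in[OF that] unfolding B_def S_def by auto
  qed (use stars occurs deliver in auto)
  moreover have "card S = (\<Sum>s = 1..t - 1. a s * (t choose (s + 1)))"
    unfolding S_def by (simp add: card_image[OF num_inj] card_subset_symbols)
  moreover have "S \<subseteq> {..<0}" unfolding S_def num_def by auto
  moreover have "B i c = Star \<longleftrightarrow> c \<in> fst (\<rho> i)" for i c unfolding B_def by simp
  ultimately show thesis by (rule that)
qed

section \<open>Rows with prescribed traces\<close>

lemma (in indexed_design) ex_rows_with_traces:
  assumes rho: "bij_betw \<rho> {1..F'} (subset_rows t a)"
    and a: "\<forall>s \<in> {1..t - 1}. of_nat (a s) \<le> lambda_trace t v k l s"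
    and x: "inj_on x {1..t}" "x ` {1..t} \<subseteq> X"
  obtains r where "inj_on r {1..F'}" "r ` {1..F'} \<subseteq> J"
    "\<And>i c. i \<in> {1..F'} \<Longrightarrow> c \<in> {1..t} \<Longrightarrow> x c \<in> blk (r i) \<longleftrightarrow> c \<in> fst (\<rho> i)"
proof -
  define T where "T = x ` {1..t}"
  have T: "T \<subseteq> X" "card T = t" using x unfolding T_def by (auto simp: card_image)
  have "\<exists>g. inj_on g {..<a (card Y)} \<and> g ` {..<a (card Y)} \<subseteq> {f \<in> J. blk f \<inter> T = x ` Y}"
    if Y: "Y \<subseteq> {1..t}" "card Y \<in> {1..t - 1}" for Y
  proof -
    have "card (x ` Y) = card Y" using x(1) Y(1) by (meson card_image inj_on_subset)
    moreover have "x ` Y \<subseteq> T" unfolding T_def using Y(1) by blast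
    ultimately have "of_nat (card {f \<in> J. blk f \<inter> T = x ` Y}) = lambda_trace t v k l (card Y)"
      using card_trace[OF T] by metis
    then have "of_nat (a (card Y)) \<le> (of_nat (card {f \<in> J. blk f \<inter> T = x ` Y}) :: rat)"
      using a Y(2) by simp
    then have "card {..<a (card Y)} \<le> card {f \<in> J. blk f \<inter> T = x ` Y}" by simp
    moreover have "finite {f \<in> J. blk f \<inter> T = x ` Y}" using finite_J by simp
    ultimately obtain g where "g ` {..<a (card Y)} \<subseteq> {f \<in> J. blk f \<inter> T = x ` Y}"
      "inj_on g {..<a (card Y)}"
      using card_le_inj[OF finite_lessThan] by metis
    then show ?thesis by (intro exI conjI)
  qed
  then have "\<forall>Y \<in> {Y. Y \<subseteq> {1..t} \<and> card Y \<in> {1..t - 1}}. \<exists>g. inj_on g {..<a (card Y)} \<and>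
      g ` {..<a (card Y)} \<subseteq> {f \<in> J. blk f \<inter> T = x ` Y}" by blast
  from bchoice[OF this] obtain g where
    g_all: "\<forall>Y \<in> {Y. Y \<subseteq> {1..t} \<and> card Y \<in> {1..t - 1}}. inj_on (g Y) {..<a (card Y)} \<and>
      g Y ` {..<a (card Y)} \<subseteq> {f \<in> J. blk f \<inter> T = x ` Y}" ..
  have g: "inj_on (g Y) {..<a (card Y)} \<and> g Y ` {..<a (card Y)} \<subseteq> {f \<in> J. blk f \<inter> T = x ` Y}"
    if "Y \<subseteq> {1..t}" "card Y \<in> {1..t - 1}" for Y
    using g_all that by blast
  \<comment> \<open>The set of row \<open>i\<close> selects the injection, and its copy number the
    block.\<close>
  define r where "r i = g (fst (\<rho> i)) (snd (\<rho> i))" for i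
  have row: "fst (\<rho> i) \<subseteq> {1..t}" "card (fst (\<rho> i)) \<in> {1..t - 1}" "snd (\<rho> i) < a (card (fst (\<rho> i)))"
    if "i \<in> {1..F'}" for i
    using bij_betw_apply[OF rho that] unfolding subset_rows_def by auto
  have r: "r i \<in> J" "blk (r i) \<inter> T = x ` fst (\<rho> i)" if "i \<in> {1..F'}" for i
    using g[OF row(1,2)[OF that]] row(3)[OF that] unfolding r_def by blast+
  have "inj_on r {1..F'}"
  proof (rule inj_onI)
    fix i j assume ij: "i \<in> {1..F'}" "j \<in> {1..F'}" "r i = r j"
    then have "x ` fst (\<rho> i) = x ` fst (\<rho> j)" using r(2) by metis
    then have e: "fst (\<rho> i) = fst (\<rho> j)"
      using x(1) row(1) ij by (meson inj_on_image_eq_iff)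
    have "inj_on (g (fst (\<rho> i))) {..<a (card (fst (\<rho> i)))}" using g row ij by blast
    then have "snd (\<rho> i) = snd (\<rho> j)"
      using row(3) ij e unfolding r_def inj_on_def by force
    then have "\<rho> i = \<rho> j" using e by (simp add: prod_eq_iff)
    then show "i = j" using rho ij unfolding bij_betw_def inj_on_def by blast
  qed
  moreover have "r ` {1..F'} \<subseteq> J" using r by blast
  moreover have "x c \<in> blk (r i) \<longleftrightarrow> c \<in> fst (\<rho> i)" if "i \<in> {1..F'}" "c \<in> {1..t}" for i c
  proof -
    have "x c \<in> blk (r i) \<longleftrightarrow> x c \<in> x ` fst (\<rho> i)"
      using r(2)[OF that(1)] that(2) unfolding T_def by blast
    also have "\<dots> \<longleftrightarrow> c \<in> fst (\<rho> i)"
      using x(1) row(1)[OF that(1)] that(2) by (meson inj_on_image_mem_iff)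
    finally show ?thesis .
  qed
  ultimately show thesis by (rule that)
qed

section \<open>The hierarchical array of a design\<close>

theorem theorem2:
  fixes X :: "'a set" and \<A> :: "'a set multiset"
    and t v k l K1 K2 :: nat and a :: "nat \<Rightarrow> nat"
  assumes "design t v k l X \<A>"
    and "\<forall>A. count \<A> A \<le> 1"
    and "0 < K1" and "0 < K2" and "K1 * K2 = v" and "K2 \<le> t"
    and "\<forall>s \<in> {1..t - 1}. of_nat (a s) \<le> lambda_trace t v k l s"
    and "of_nat (\<Sum>s = 1..t - 1. a s * (t choose s)) > lambda_in t v k l 1"
  shows "\<exists>K' F F' Z1 Z2 Z' S SS Q B.
     (if K2 = 1 then HHPDA_relaxed K1 K2 K' F F' Z1 Z2 Z' S SS Q B
      else HHPDA K1 K2 K' F F' Z1 Z2 Z' S SS Q B) \<and>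
     K' = t \<and>
     F = size \<A> \<and>
     F' = (\<Sum>s = 1..t - 1. a s * (t choose s)) \<and>
     of_nat Z1 = lambda_in t v k l K2 \<and>
     of_nat Z2 = lambda_in t v k l 1 - lambda_in t v k l K2 \<and>
     Z' = (\<Sum>s = 1..t - 1. a s * ((t - 1) choose (s - 1))) \<and>
     card S = (\<Sum>s = 1..t - 1. a s * (t choose (s + 1))) \<and>
     (\<forall>k1 \<in> {1..K1}. of_nat (card (SS k1)) = lambda_in t v k l K2 * of_nat K2)"
proof -

  \<comment> \<open>Numbering the blocks as rows\<close>
  obtain bs where bs: "mset bs = \<A>" using ex_mset by blast
  define F where "F = size \<A>"
  \<comment> \<open>Rows are counted from 1 and list positions from 0, hence the shift.\<close>
  define blk where "blk f = bs ! (f - 1)" for f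
  have len: "length bs = F" unfolding F_def bs[symmetric] by simp
  have count: "size {#A \<in># \<A>. P A#} = card {f \<in> {1..F}. P (blk f)}" for P
  proof -
    have "size {#A \<in># \<A>. P A#} = length (filter P bs)"
      unfolding bs[symmetric] by (metis mset_filter size_mset)
    also have "\<dots> = card {i. i < F \<and> P (bs ! i)}" by (simp add: length_filter_conv_card len)
    also have "\<dots> = card {f \<in> {1..F}. P (blk f)}"
      unfolding blk_def
      by (rule bij_betw_same_card[of Suc], rule bij_betw_byWitness[where f' = "\<lambda>f. f - 1"]) auto
    finally show ?thesis .
  qed
  have blk_in: "blk f \<in># \<A>" if "f \<in> {1..F}" for f
    using that len unfolding bs[symmetric] blk_def by auto
  interpret indexed_design t v k l X "{1..F}" blk
    using assms(1) blk_in unfolding design_def by unfold_locales (auto simp: count)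

  \<comment> \<open>Identifying users with points\<close>
  have "card ({1..K1} \<times> {1..K2}) = card X" using assms(5) card_X by simp
  then obtain \<phi> where phi: "bij_betw \<phi> ({1..K1} \<times> {1..K2}) X"
    using finite_X by (metis finite_SigmaI finite_atLeastAtMost finite_same_card_bij)
  define G where "G k1 = \<phi> ` ({k1} \<times> {1..K2})" for k1
  have phi_in: "\<phi> (k1, k2) \<in> X" if "k1 \<in> {1..K1}" "k2 \<in> {1..K2}" for k1 k2
    using phi that bij_betw_apply by fastforce
  have G: "G k1 \<subseteq> X" "card (G k1) = K2" if "k1 \<in> {1..K1}" for k1
  proof -
    show "G k1 \<subseteq> X" using phi_in that unfolding G_def by auto
    have "inj_on \<phi> ({k1} \<times> {1..K2})"
      using phi that unfolding bij_betw_def by (elim conjE inj_on_subset) auto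
    then show "card (G k1) = K2" unfolding G_def by (simp add: card_image)
  qed
  have phi_G: "\<phi> (k1, k2) \<in> G k1" if "k2 \<in> {1..K2}" for k1 k2 using that unfolding G_def by auto

  \<comment> \<open>The delivery array \<open>B\<close>\<close>
  define F' where "F' = (\<Sum>s = 1..t - 1. a s * (t choose s))"
  define Z' where "Z' = (\<Sum>s = 1..t - 1. a s * ((t - 1) choose (s - 1)))"
  obtain \<rho> where rho: "bij_betw \<rho> {1..F'} (subset_rows t a)"
    using ex_bij_betw_nat_finite_1[OF finite_subset_rows] unfolding card_subset_rows F'_def by blast
  obtain S B where PDA: "PDA t F' Z' (card S) S B"
    and card_S: "card S = (\<Sum>s = 1..t - 1. a s * (t choose (s + 1)))"
    and S_neg: "S \<subseteq> {..<0}"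
    and B_star: "\<And>i c. B i c = Star \<longleftrightarrow> c \<in> fst (\<rho> i)"
    using ex_subset_PDA[OF rho] unfolding Z'_def by blast

  \<comment> \<open>The arrays \<open>Q\<close> and their integers\<close>
  \<comment> \<open>Each integer encodes its own position (subarray, row, column), so none is ever
    repeated.\<close>
  define num where "num k1 f k2 = int (prod_encode (k1, prod_encode (f, k2)))" for k1 f k2
  have num_eq: "num k1 f k2 = num k1' f' k2' \<longleftrightarrow> k1 = k1' \<and> f = f' \<and> k2 = k2'"
    for k1 f k2 k1' f' k2'
    unfolding num_def by simp
  \<comment> \<open>For \<open>k0 = 0\<close> the column index \<open>c\<close> is itself the first
    coordinate of a group.\<close>
  define Q where "Q k0 f c =
      (if k0 = 0 then if G c \<subseteq> blk f then Star else Null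
       else if G k0 \<subseteq> blk f then Num (num k0 f c)
       else if \<phi> (k0, c) \<in> blk f then Star else Null)" for k0 f c
  define SS where "SS k1 = (\<lambda>(f, k2). num k1 f k2) ` ({f \<in> {1..F}. G k1 \<subseteq> blk f} \<times> {1..K2})" for k1
  have Num_in: "Num (num k1 f k2) \<in> Num ` SS k1"
    if "f \<in> {1..F}" "k2 \<in> {1..K2}" "G k1 \<subseteq> blk f" for k1 f k2
    using that unfolding SS_def by (intro imageI image_eqI[where x = "(f, k2)"]) auto
  \<comment> \<open>Both numbers are counted at one representative, the group \<open>G 1\<close> and
    the user \<open>(1, 1)\<close>; the design property gives the same value for every group and
    every user.\<close>
  define Z1 where "Z1 = card {f \<in> {1..F}. G 1 \<subseteq> blk f}"
  define r1 where "r1 = card {f \<in> {1..F}. {\<phi> (1, 1)} \<subseteq> blk f}"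

  \<comment> \<open>Star counts and size inequalities\<close>
  have G_rat: "of_nat (card {f \<in> {1..F}. G k1 \<subseteq> blk f}) = lambda_in t v k l K2" if "k1 \<in> {1..K1}" for k1
    using card_containing[OF G(1)[OF that]] G(2)[OF that] assms(6) by simp
  have one: "1 \<in> {1..K1}" "1 \<in> {1..K2}" using assms(3,4) by auto
  have Z1_rat: "of_nat Z1 = lambda_in t v k l K2" unfolding Z1_def using G_rat one by blast
  have G_card: "card {f \<in> {1..F}. G k1 \<subseteq> blk f} = Z1" if "k1 \<in> {1..K1}" for k1
  proof -
    have "(of_nat (card {f \<in> {1..F}. G k1 \<subseteq> blk f}) :: rat) = of_nat Z1"
      using G_rat[OF that] Z1_rat by simp
    then show ?thesis by (simp only: of_nat_eq_iff)
  qed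
  have pt_rat: "of_nat (card {f \<in> {1..F}. {\<phi> (k1, k2)} \<subseteq> blk f}) = lambda_in t v k l 1"
    if "k1 \<in> {1..K1}" "k2 \<in> {1..K2}" for k1 k2
    using card_containing[of "{\<phi> (k1, k2)}"] phi_in[OF that] t_pos by simp
  have r1_rat: "of_nat r1 = lambda_in t v k l 1" unfolding r1_def using pt_rat one by blast
  have pt_card: "card {f \<in> {1..F}. \<phi> (k1, k2) \<in> blk f} = r1"
    if "k1 \<in> {1..K1}" "k2 \<in> {1..K2}" for k1 k2
  proof -
    have "(of_nat (card {f \<in> {1..F}. {\<phi> (k1, k2)} \<subseteq> blk f}) :: rat) = of_nat r1"
      using pt_rat[OF that] r1_rat by simp
    then show ?thesis by (simp only: of_nat_eq_iff) simp
  qed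
  \<comment> \<open>The stars in this column are the blocks containing the user's point but not its
    whole group.\<close>
  have stars_Q: "col_stars F (Q k1) k2 = r1 - Z1" if "k1 \<in> {1..K1}" "k2 \<in> {1..K2}" for k1 k2
  proof -
    have "{f \<in> {1..F}. Q k1 f k2 = Star} =
          {f \<in> {1..F}. \<phi> (k1, k2) \<in> blk f} - {f \<in> {1..F}. G k1 \<subseteq> blk f}"
      using that unfolding Q_def by auto
    moreover have "{f \<in> {1..F}. G k1 \<subseteq> blk f} \<subseteq> {f \<in> {1..F}. \<phi> (k1, k2) \<in> blk f}"
      using phi_G[OF that(2)] by auto
    ultimately show ?thesis
      unfolding col_stars_def using pt_card[OF that] G_card[OF that(1)]
      by (simp add: card_Diff_subset)
  qed
  have stars_Q0: "col_stars F (Q 0) k1 = Z1" if "k1 \<in> {1..K1}" for k1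
  proof -
    have "{f \<in> {1..F}. Q 0 f k1 = Star} = {f \<in> {1..F}. G k1 \<subseteq> blk f}" unfolding Q_def by auto
    then show ?thesis using G_card[OF that] unfolding col_stars_def by simp
  qed
  have Z1_le: "Z1 \<le> r1"
    unfolding Z1_def r1_def using phi_G[OF one(2)] by (intro card_mono) auto
  have Z2_pos: "Z1 < r1" if "K2 \<noteq> 1"
  proof -
    have "lambda_in t v k l K2 < lambda_in t v k l 1"
      using that assms(4,6) by (intro lambda_in_less l_pos t_le_k k_less_v) auto
    then have "(of_nat Z1 :: rat) < of_nat r1" using Z1_rat r1_rat by simp
    then show ?thesis by simp
  qed
  have Z1_pos: "0 < Z1"
  proof -
    have "(0 :: rat) < of_nat Z1" using lambda_in_pos assms(6) l_pos t_le_k k_less_v Z1_rat by simp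
    then show ?thesis by simp
  qed
  \<comment> \<open>Since \<open>Z1 + (r1 - Z1) = r1\<close>, this is the required bound on the
    stars; it comes from the hypothesis that the sum exceeds
    \<open>lambda_in t v k l 1\<close>.\<close>
  have r1_less: "r1 < F'"
  proof -
    have "(of_nat r1 :: rat) < of_nat F'" using assms(8) r1_rat unfolding F'_def by simp
    then show ?thesis by (simp only: of_nat_less_iff)
  qed
  \<comment> \<open>An index \<open>s\<close> with a nonzero term in \<open>F'\<close> also has a
    nonzero term in \<open>Z'\<close>.\<close>
  have Z'_pos: "0 < Z'"
  proof -
    have "F' \<noteq> 0" using r1_less by simp
    then obtain s where s: "s \<in> {1..t - 1}" "a s * (t choose s) \<noteq> 0"
      unfolding F'_def by (meson sum.neutral)
    then have "a s * ((t - 1) choose (s - 1)) \<noteq> 0" by auto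
    then show ?thesis unfolding Z'_def using s(1) by (meson finite_atLeastAtMost gr0I sum_eq_0_iff)
  qed

  \<comment> \<open>The hotplug condition for a set of active users\<close>
  have hotplug: "\<exists>\<zeta> r. \<zeta> \<subseteq> {1..F} \<and> card \<zeta> = F' \<and> bij_betw r {1..F'} \<zeta> \<and>
      star_equal F' t (hotplug_sub Q r \<tau>) B"
    if tau: "\<tau> \<subseteq> {1..K1} \<times> {1..K2}" "card \<tau> = t" for \<tau>
  proof -
    have "finite \<tau>" using tau(1) finite_subset by blast
    define col where "col c = sorted_list_of_set \<tau> ! (c - 1)" for c
    have "bij_betw ((!) (sorted_list_of_set \<tau>)) {..<t} \<tau>"
      using \<open>finite \<tau>\<close> tau(2) by (intro bij_betw_nth) auto
    moreover have "bij_betw (\<lambda>c. c - 1) {1..t} {..<t}"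
      by (rule bij_betw_byWitness[where f' = Suc]) auto
    ultimately have col: "bij_betw col {1..t} \<tau>"
      unfolding col_def using bij_betw_trans unfolding comp_def by fastforce
    have col_in: "col c \<in> {1..K1} \<times> {1..K2}" if "c \<in> {1..t}" for c
      using bij_betw_apply[OF col that] tau(1) by blast
    have "inj_on \<phi> \<tau>" using phi tau(1) unfolding bij_betw_def by (meson inj_on_subset)
    then have x1: "inj_on (\<phi> \<circ> col) {1..t}"
      using col unfolding bij_betw_def by (simp add: comp_inj_on)
    have x2: "(\<phi> \<circ> col) ` {1..t} \<subseteq> X"
      using col_in phi unfolding bij_betw_def by fastforce
    obtain r where r: "inj_on r {1..F'}" "r ` {1..F'} \<subseteq> {1..F}"
      "\<And>i c. i \<in> {1..F'} \<Longrightarrow> c \<in> {1..t} \<Longrightarrow> (\<phi> \<circ> col) c \<in> blk (r i) \<longleftrightarrow> c \<in> fst (\<rho> i)"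
      using ex_rows_with_traces[OF rho assms(7) x1 x2] by blast
    have "hotplug_sub Q r \<tau> i c = Star \<longleftrightarrow> B i c = Star" if ic: "i \<in> {1..F'}" "c \<in> {1..t}" for i c
    proof -
      obtain k1 k2 where c: "col c = (k1, k2)" "k1 \<in> {1..K1}" "k2 \<in> {1..K2}"
        using col_in[OF ic(2)] by auto
      have "hotplug_sub Q r \<tau> i c = Star \<longleftrightarrow> Q 0 (r i) k1 = Star \<or> Q k1 (r i) k2 = Star"
        using c(1) unfolding hotplug_sub_def hotplug_entry_def col_def by simp
      \<comment> \<open>If the whole group lies in the block, the star is in \<open>Q 0\<close> and
        the point is in the block by \<open>phi_G\<close>; otherwise \<open>Q k1\<close>
        decides.\<close>
      also have "\<dots> \<longleftrightarrow> \<phi> (k1, k2) \<in> blk (r i)"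
        using c phi_G[OF c(3)] unfolding Q_def by auto
      also have "\<dots> \<longleftrightarrow> B i c = Star" using r(3)[OF ic] c(1) B_star by simp
      finally show ?thesis .
    qed
    then have "star_equal F' t (hotplug_sub Q r \<tau>) B" unfolding star_equal_def by blast
    moreover have "bij_betw r {1..F'} (r ` {1..F'})" "card (r ` {1..F'}) = F'"
      using r(1) by (auto simp: bij_betw_def card_image)
    ultimately show ?thesis using r(2) by blast
  qed
  \<comment> \<open>\<open>F' \<le> F\<close> comes from the hotplug condition itself: applied to
    any one set of \<open>t\<close> users, it yields \<open>F'\<close> distinct rows among
    \<open>F\<close>.\<close>
  have t_le_v: "t \<le> K1 * K2" using t_le_k k_less_v assms(5) by simp
  then obtain \<tau>0 where "\<tau>0 \<subseteq> {1..K1} \<times> {1..K2}" "card \<tau>0 = t"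
    using obtain_subset_with_card_n[of t "{1..K1} \<times> {1..K2}"] by (auto simp: card_cartesian_product)
  then obtain \<zeta>0 where "\<zeta>0 \<subseteq> {1..F}" "card \<zeta>0 = F'" using hotplug by blast
  then have F'_le: "F' \<le> F" using card_mono[of "{1..F}" \<zeta>0] by simp

  \<comment> \<open>Checking the conditions and parameters\<close>
  have relaxed: "HHPDA_relaxed K1 K2 t F F' Z1 (r1 - Z1) Z' S SS Q B"
    unfolding HHPDA_relaxed_def
  proof (intro conjI ballI allI impI)
    show "S \<inter> SS k1 = {}" for k1 using S_neg unfolding SS_def num_def by fastforce
    show "Q 0 f k1 \<in> {Star, Null}" for f k1 unfolding Q_def by auto
    show "Q k1 f k2 \<in> {Star, Null} \<union> Num ` SS k1"
      if "k1 \<in> {1..K1}" "f \<in> {1..F}" "k2 \<in> {1..K2}" for k1 f k2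
      using that Num_in unfolding Q_def by auto
    show "\<exists>f\<in>{1..F}. \<exists>k2\<in>{1..K2}. Q k1 f k2 = Num s" if "k1 \<in> {1..K1}" "s \<in> SS k1" for k1 s
      using that unfolding SS_def Q_def by auto
    show "Q 0 f c \<noteq> Num s" for f c s unfolding Q_def by auto
    show "Q k1' f k2 \<noteq> Num s" if "k1 \<in> {1..K1}" "s \<in> SS k1" "k1' \<in> {1..K1} - {k1}" for k1 s k1' f k2
      using that unfolding SS_def Q_def by (auto simp: num_eq)
    show "Q k1 f k2 \<in> {Star} \<union> Num ` SS k1"
      if "f \<in> {1..F}" "k1 \<in> {1..K1}" "k2 \<in> {1..K2}" "Q 0 f k1 = Star" for f k1 k2
      using that Num_in unfolding Q_def by (auto split: if_splits)
    \<comment> \<open>Vacuous, as no integer occurs at two positions of \<open>Q k1\<close>.\<close>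
    show "delivery_cond K2 F (SS k1) (Q k1)" if "k1 \<in> {1..K1}" for k1
      using that unfolding delivery_cond_def Q_def by (auto simp: num_eq split: if_splits)
  qed (use assms(3,4) t_pos r1_less F'_le Z1_pos Z'_pos Z1_le t_le_v stars_Q stars_Q0 PDA hotplug in auto)
  have card_SS: "of_nat (card (SS k1)) = lambda_in t v k l K2 * of_nat K2" if "k1 \<in> {1..K1}" for k1
  proof -
    have "inj_on (\<lambda>(f, k2). num k1 f k2) ({f \<in> {1..F}. G k1 \<subseteq> blk f} \<times> {1..K2})"
      by (auto simp: inj_on_def num_eq)
    then have "card (SS k1) = Z1 * K2"
      unfolding SS_def using G_card[OF that] by (simp add: card_image card_cartesian_product)
    then show ?thesis using Z1_rat by simp
  qed
  \<comment> \<open>For \<open>K2 = 1\<close> a group is a single point and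
    \<open>r1 - Z1 = 0\<close>; otherwise \<open>Z2_pos\<close> supplies the missing
    positivity.\<close>
  have "(if K2 = 1 then HHPDA_relaxed K1 K2 t F F' Z1 (r1 - Z1) Z' S SS Q B
         else HHPDA K1 K2 t F F' Z1 (r1 - Z1) Z' S SS Q B)"
    using relaxed Z2_pos unfolding HHPDA_def by (metis zero_less_diff)
  moreover have "of_nat (r1 - Z1) = lambda_in t v k l 1 - lambda_in t v k l K2"
    using Z1_le Z1_rat r1_rat by (simp add: of_nat_diff)
  ultimately show ?thesis
    using Z1_rat card_S card_SS unfolding F_def F'_def Z'_def by blast
qed

end
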